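(* Let $\mathcal{P}$ be a finite set of integer pairs $p=(p_1,p_2)$ with $0\le p_1\le p_2$ and $p_2\neq 0$, and let $\{A_p\}_{p\in\mathcal{P}}$ be real numbers satisfying $8\sum_{p\in\mathcal{P}}c_pA_p=1$ and such that $\sum_{p\in\mathcal{P}}\|p\|^2c_pA_p\neq0$, and put $$\mathcal{M}_\mathcal{P}=\frac12\Big(\sum_{p\in\mathcal{P}}\|p\|^2c_pA_p\Big)^{-1}.$$ For $f,g\in C^1(S)$ and an integer $m\ge0$ define $$\mathcal{E}_m(f,g)=\mathcal{M}_\mathcal{P}\sum_{p\in\mathcal{P}}\Big(A_p\sum_{\substack{|w|=|w'|=m,\\ F_{w'}S\sim_pF_wS}}\big(B_{w'}(f)-B_w(f)\big)\big(B_{w'}(g)-B_w(g)\big)\Big),$$ where the inner sum runs over unordered pairs $\{w,w'\}$ of words of length $m$ whose cells are $p$-neighbors. Then for all $f,g\in C^1(S)$ the limit $\mathcal{E}(f,g):=\lim_{m\to\infty}\mathcal{E}_m(f,g)$ exists and $$\mathcal{E}(f,g)=\int_S\nabla f\cdot\nabla g\,d\mu.$$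
   Context: $\mu$ is Lebesgue measure on $\mathbb{R}^2$ and $\|\cdot\|$ is the Euclidean norm. $S=[0,1]^2$ is the closed unit square, viewed as the self-similar set of the maps $F_i(x)=\frac12(x+q_i)$, $i=1,2,3,4$, with $q_1=(0,0)$, $q_2=(1,0)$, $q_3=(1,1)$, $q_4=(0,1)$. For a word $w=(w_1,\dots,w_m)\in\{1,2,3,4\}^m$ (length $|w|=m$), $F_w=F_{w_1}\circ\cdots\circ F_{w_m}$ (the identity if $m=0$); the $m$-cell $F_wS$ is a closed square of side $2^{-m}$. $B_w(f)=\frac{1}{\mu(F_wS)}\int_{F_wS}f\,d\mu$. $C^1(S)$ denotes the functions that are continuously differentiable on the closed square $S$ (up to the boundary). For $x=(x_1,x_2)$ and $l>0$, $\mathcal{D}(x,l)$ is the closed axis-parallel square with center $x$ and side length $l$. For an integer pair $p=(p_1,p_2)$ with $0\le p_1\le p_2$, $\mathcal{D}(x,l)\sim_p\mathcal{D}(x',l)$ ($p$-neighbors) means that either $|x_1-x_1'|=p_1l$ and $|x_2-x_2'|=p_2l$, or $|x_1-x_1'|=p_2l$ and $|x_2-x_2'|=p_1l$; this applies to the cells $F_wS$, which are such squares with $l=2^{-m}$. The constant $c_p$ is $\frac18$ if $p_1=p_2=0$; $\frac12$ if $p_1=0,p_2\ne0$ or $p_1=p_2\neq0$; and $1$ if $0<p_1<p_2$. *)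

theory Defs
  imports "HOL-Analysis.Analysis" "HOL-Library.Uprod"
begin

subsection \<open>The square and its cells\<close>

definition unit_square :: "(real^2) set" where
  "unit_square = cbox 0 1"

definition corner :: "nat \<Rightarrow> real^2" where
  "corner i =
    (if i = 1 then vector [0, 0]
     else if i = 2 then vector [1, 0]
     else if i = 3 then vector [1, 1]
     else vector [0, 1])"

definition F :: "nat \<Rightarrow> real^2 \<Rightarrow> real^2" where
  "F i x = (1/2) *\<^sub>R (x + corner i)"

definition words :: "nat \<Rightarrow> nat list set" where
  "words m = {w. length w = m \<and> set w \<subseteq> {1, 2, 3, 4}}"

text \<open>The head of the list is the outermost map.\<close>

fun F_word :: "nat list \<Rightarrow> real^2 \<Rightarrow> real^2" where
  "F_word [] = id"
| "F_word (i # w) = F i \<circ> F_word w"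

definition cell :: "nat list \<Rightarrow> (real^2) set" where
  "cell w = F_word w ` unit_square"

definition cell_avg :: "nat list \<Rightarrow> (real^2 \<Rightarrow> real) \<Rightarrow> real" where
  "cell_avg w f = 1 / measure lebesgue (cell w) * (LINT x:cell w|lebesgue. f x)"

subsection \<open>Neighbouring squares\<close>

definition square :: "real^2 \<Rightarrow> real \<Rightarrow> (real^2) set" where
  "square x l = {y. \<bar>y$1 - x$1\<bar> \<le> l/2 \<and> \<bar>y$2 - x$2\<bar> \<le> l/2}"

text \<open>Centre and side length are determined by a nondegenerate square, so that being
  \<open>p\<close>-neighbours is a relation between sets.\<close>

definition neighbors :: "int \<times> int \<Rightarrow> (real^2) set \<Rightarrow> (real^2) set \<Rightarrow> bool" where
  "neighbors p D D' \<longleftrightarrow>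
    (\<exists>x x' l. l > 0 \<and> D = square x l \<and> D' = square x' l \<and>
      (\<bar>x$1 - x'$1\<bar> = of_int (fst p) * l \<and> \<bar>x$2 - x'$2\<bar> = of_int (snd p) * l \<or>
       \<bar>x$1 - x'$1\<bar> = of_int (snd p) * l \<and> \<bar>x$2 - x'$2\<bar> = of_int (fst p) * l))"

definition neighbor_pairs :: "int \<times> int \<Rightarrow> nat \<Rightarrow> nat list uprod set" where
  "neighbor_pairs p m =
    {Upair w w' | w w'. w \<in> words m \<and> w' \<in> words m \<and> neighbors p (cell w') (cell w)}"

subsection \<open>Discrete energies\<close>

definition c :: "int \<times> int \<Rightarrow> real" where
  "c p =
    (if fst p = 0 \<and> snd p = 0 then 1/8
     else if fst p = 0 \<or> fst p = snd p then 1/2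
     else 1)"

definition pnorm :: "int \<times> int \<Rightarrow> real" where
  "pnorm p = norm (vector [of_int (fst p), of_int (snd p)] :: real^2)"

definition M_const :: "(int \<times> int) set \<Rightarrow> (int \<times> int \<Rightarrow> real) \<Rightarrow> real" where
  "M_const P A = (1/2) * inverse (\<Sum>p\<in>P. (pnorm p)\<^sup>2 * c p * A p)"

text \<open>The summand is symmetric in the two words, hence a function of the unordered pair.\<close>

lift_definition diff_product ::
    "(real^2 \<Rightarrow> real) \<Rightarrow> (real^2 \<Rightarrow> real) \<Rightarrow> nat list uprod \<Rightarrow> real"
  is "\<lambda>f g (w, w'). (cell_avg w' f - cell_avg w f) * (cell_avg w' g - cell_avg w g)"
  by (auto simp: algebra_simps)

lemma diff_product_Upair [simp]:
  "diff_product f g (Upair w w') =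
    (cell_avg w' f - cell_avg w f) * (cell_avg w' g - cell_avg w g)"
  by transfer simp

definition discrete_energy ::
    "(int \<times> int) set \<Rightarrow> (int \<times> int \<Rightarrow> real) \<Rightarrow> nat
      \<Rightarrow> (real^2 \<Rightarrow> real) \<Rightarrow> (real^2 \<Rightarrow> real) \<Rightarrow> real" where
  "discrete_energy P A m f g =
    M_const P A * (\<Sum>p\<in>P. A p * (\<Sum>e\<in>neighbor_pairs p m. diff_product f g e))"

definition energy ::
    "(int \<times> int) set \<Rightarrow> (int \<times> int \<Rightarrow> real)
      \<Rightarrow> (real^2 \<Rightarrow> real) \<Rightarrow> (real^2 \<Rightarrow> real) \<Rightarrow> real" where
  "energy P A f g = lim (\<lambda>m. discrete_energy P A m f g)"

subsection \<open>Continuously differentiable functions on the closed square\<close>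

text \<open>Derivatives are taken within the square, so that they are one-sided on its boundary
  and the values of \<open>f\<close> outside the square play no role.  On the square the gradient of a
  differentiable function is unique (see \<open>grad_unique\<close>).\<close>

definition grad :: "(real^2 \<Rightarrow> real) \<Rightarrow> real^2 \<Rightarrow> real^2" where
  "grad f x = (SOME v. (f has_derivative (\<lambda>h. v \<bullet> h)) (at x within unit_square))"

definition C1_square :: "(real^2 \<Rightarrow> real) set" where
  "C1_square = {f. f differentiable_on unit_square \<and> continuous_on unit_square (grad f)}"

lemma grad_unique:
  assumes x: "x \<in> unit_square"
    and f: "(f has_derivative (\<lambda>h. v \<bullet> h)) (at x within unit_square)"
  shows "grad f x = v"
proof -
  have *: "u = v" if u: "(f has_derivative (\<lambda>h. u \<bullet> h)) (at x within unit_square)" for u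
  proof -
    have "(\<lambda>h. u \<bullet> h) = (\<lambda>h. v \<bullet> h)"
    proof (rule frechet_derivative_unique_within_closed_interval)
      show "(0::real^2) \<bullet> i < 1 \<bullet> i" if "i \<in> Basis" for i
        using that by (auto simp: Basis_vec_def inner_axis)
      show "x \<in> cbox 0 1"
        using x by (simp add: unit_square_def)
    qed (use u f in \<open>simp_all add: unit_square_def\<close>)
    then show ?thesis
      unfolding fun_eq_iff vector_eq_rdot .
  qed
  show ?thesis
    unfolding grad_def using f * by (rule some_equality)
qed

end

theory Submission
  imports Defs
begin

text \<open>
  Let \<open>N = 2 ^ m\<close>.  The cells of level \<open>m\<close> are the squares of side \<open>1/N\<close> with lower left
  corner \<open>k/N\<close>, where \<open>k\<close> runs over the integer grid \<open>{0..<N} \<times> {0..<N}\<close>, and the cells of \<open>k\<close>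
  and \<open>l\<close> are \<open>p\<close>-neighbours exactly when \<open>l - k\<close> arises from \<open>p\<close> by changing signs and swapping
  the coordinates (\<open>neighbors_cells_iff\<close>).  Summing over ordered pairs counts every unordered pair
  twice, so the sum over \<open>p\<close>-neighbours is half the sum, over all such displacements \<open>v\<close>, of the
  energy of the single shift \<open>v\<close> (\<open>sum_neighbor_pairs\<close>).

  For a fixed \<open>v\<close>, the difference of the means of \<open>f\<close> over the cells of \<open>k + v\<close> and \<open>k\<close> is the mean
  of \<open>f (x + v/N) - f x\<close> over the cell of \<open>k\<close>.  By the mean value theorem, \<open>N\<close> times it is close to
  \<open>\<nabla>f \<bullet> v\<close> near that cell.  A cell has area \<open>1/N\<^sup>2\<close>, so the sum of the products of these differences for
  \<open>f\<close> and \<open>g\<close> is the integral of a bounded step function which converges to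
  \<open>(\<nabla>f \<bullet> v) (\<nabla>g \<bullet> v)\<close> at every interior point of the square.  The cells whose shift by \<open>v\<close> leaves
  the square contribute the value \<open>0\<close>; since an interior point is eventually not in such a cell,
  dominated convergence (\<open>shift_energy_tendsto\<close>) also takes care of the boundary.

  Finally the displacements of \<open>p\<close> are isotropic: by the symmetries of the square, the sum of
  \<open>v v\<^sup>T\<close> over them is the multiple \<open>4 \<parallel>p\<parallel>\<^sup>2 c\<^sub>p\<close> of the identity matrix (\<open>displacements_isotropic\<close>),
  where \<open>8 c\<^sub>p\<close> is the number of displacements.  The neighbour sums for \<open>p\<close> thus tend to
  \<open>2 \<parallel>p\<parallel>\<^sup>2 c\<^sub>p\<close> times the Dirichlet integral, and the prefactor of the energy normalizes the
  total weight to \<open>1\<close>.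
\<close>

section \<open>Words and grid points\<close>

definition lattice_point :: "int \<times> int \<Rightarrow> real^2" where
  "lattice_point k = vector [of_int (fst k), of_int (snd k)]"

lemma lattice_point_nth [simp]:
  "lattice_point k $ 1 = of_int (fst k)" "lattice_point k $ 2 = of_int (snd k)"
  by (simp_all add: lattice_point_def)

lemma lattice_point_add: "lattice_point (k + v) = lattice_point k + lattice_point v"
  by (simp add: vec_eq_iff forall_2)

lemma unit_square_iff: "x \<in> unit_square \<longleftrightarrow> 0 \<le> x$1 \<and> x$1 \<le> 1 \<and> 0 \<le> x$2 \<and> x$2 \<le> 1"
  by (auto simp: unit_square_def mem_box_cart forall_2)

definition grid :: "nat \<Rightarrow> (int \<times> int) set" where
  "grid N = {0..<int N} \<times> {0..<int N}"

text \<open>Each letter contributes one binary digit to both coordinates.  The head of a word is the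
  outermost map, so it carries the most significant digits.\<close>

fun index :: "nat list \<Rightarrow> int \<times> int" where
  "index [] = (0, 0)"
| "index (i # w) =
    ((if i = 2 \<or> i = 3 then 2 ^ length w else 0) + fst (index w),
     (if \<not> (i = 1 \<or> i = 2) then 2 ^ length w else 0) + snd (index w))"

lemma F_word_eq: "F_word w y = (1 / 2 ^ length w) *\<^sub>R (lattice_point (index w) + y)"
  by (induction w) (auto simp: vec_eq_iff forall_2 F_def corner_def field_simps)

lemma index_in_grid: "w \<in> words m \<Longrightarrow> index w \<in> grid (2 ^ m)"
proof (induction w arbitrary: m)
  case (Cons i w)
  then obtain n where "m = Suc n" "w \<in> words n"
    by (cases m) (auto simp: words_def)
  with Cons.IH[of n] show ?case
    by (auto simp: grid_def words_def mem_Times_iff)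
qed (auto simp: words_def grid_def)

lemma leading_digit_inject:
  fixes x y b :: int
  assumes "0 \<le> x" "x < b" "0 \<le> y" "y < b" "(if P then b else 0) + x = (if Q then b else 0) + y"
  shows "P = Q" "x = y"
  using assms by (auto split: if_splits)

lemma inj_on_index: "inj_on index (words m)"
proof (rule inj_onI)
  show "w = u" if "w \<in> words m" "u \<in> words m" "index w = index u" for w u
    using that
  proof (induction w arbitrary: u m)
    case (Cons i w)
    then obtain n where m: "m = Suc n" and w: "w \<in> words n" and i: "i \<in> {1,2,3,4}"
      by (cases m) (auto simp: words_def)
    then obtain j u' where u: "u = j # u'" "u' \<in> words n" and j: "j \<in> {1,2,3,4}"
      using Cons.prems(2) by (cases u) (auto simp: words_def)
    have len: "length w = n" "length u' = n" using w u by (auto simp: words_def)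
    have "index w \<in> grid (2^n)" "index u' \<in> grid (2^n)"
      using w u index_in_grid by blast+
    then have b: "0 \<le> fst (index w)" "fst (index w) < 2^n" "0 \<le> snd (index w)" "snd (index w) < 2^n"
      "0 \<le> fst (index u')" "fst (index u') < 2^n" "0 \<le> snd (index u')" "snd (index u') < 2^n"
      by (auto simp: grid_def mem_Times_iff)
    have e: "fst (index (i # w)) = fst (index (j # u'))" "snd (index (i # w)) = snd (index (j # u'))"
      using Cons.prems(3) u(1) by simp_all
    have "(if i = 2 \<or> i = 3 then 2^n else 0) + fst (index w) = (if j = 2 \<or> j = 3 then 2^n else 0) + fst (index u')"
      "(if \<not> (i = 1 \<or> i = 2) then 2^n else 0) + snd (index w) = (if \<not> (j = 1 \<or> j = 2) then 2^n else 0) + snd (index u')"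
      using e by (simp_all only: len index.simps fst_conv snd_conv)
    from leading_digit_inject[OF b(1,2,5,6) this(1)] leading_digit_inject[OF b(3,4,7,8) this(2)]
    have ij: "i = j" and "index w = index u'"
      using i j by (auto simp: prod_eq_iff)
    with Cons.IH[OF w u(2)] ij u(1) show ?case by simp
  qed (auto simp: words_def)
qed

lemma finite_grid: "finite (grid N)"
  by (simp add: grid_def)

lemma bij_betw_index: "bij_betw index (words m) (grid (2 ^ m))"
proof -
  have "card {1::nat, 2, 3, 4} = 4" by simp
  then have "card (words m) = 4 ^ m"
    using card_lists_length_eq[of "{1::nat, 2, 3, 4}" m] unfolding words_def by (simp only: conj_commute finite.intros)
  moreover have "card (grid (2^m)) = 4 ^ m"
    using power_mult_distrib[of "2::nat" 2 m] by (simp add: grid_def card_cartesian_product nat_power_eq)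
  moreover have "index ` words m \<subseteq> grid (2^m)" using index_in_grid by blast
  moreover note finite_grid[of "2^m"]
  ultimately show ?thesis
    using card_subset_eq[of "grid (2^m)" "index ` words m"] card_image[OF inj_on_index, of m]
    by (simp add: bij_betw_def inj_on_index)
qed

lemma mem_cell_iff: "y \<in> cell w \<longleftrightarrow> 2 ^ length w *\<^sub>R y - lattice_point (index w) \<in> unit_square"
proof
  assume *: "2 ^ length w *\<^sub>R y - lattice_point (index w) \<in> unit_square"
  have "y = F_word w (2 ^ length w *\<^sub>R y - lattice_point (index w))"
    by (simp add: F_word_eq)
  with * show "y \<in> cell w" unfolding cell_def by blast
qed (auto simp: cell_def F_word_eq)

lemma cell_eq_square:
  "cell w = square ((1 / 2 ^ length w) *\<^sub>R (lattice_point (index w) + vector [1/2, 1/2])) (1 / 2 ^ length w)"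
proof -
  have *: "0 \<le> n * s - k \<and> n * s - k \<le> 1 \<longleftrightarrow> \<bar>s - (1 / n) * (k + 1/2)\<bar> \<le> 1 / n / 2" if "n > 0" for n s k :: real
  proof -
    have "s - (1 / n) * (k + 1/2) = (n * s - k - 1/2) / n"
      using that by (simp add: field_simps)
    then have "\<bar>s - (1 / n) * (k + 1/2)\<bar> \<le> 1 / n / 2 \<longleftrightarrow> \<bar>n * s - k - 1/2\<bar> / n \<le> (1 / 2) / n"
      using that by (simp add: mult.commute)
    also have "\<dots> \<longleftrightarrow> \<bar>n * s - k - 1/2\<bar> \<le> 1 / 2"
      using that by (simp only: divide_le_cancel) simp
    finally show ?thesis by linarith
  qed
  have "2 ^ length w *\<^sub>R y - lattice_point (index w) \<in> unit_square \<longleftrightarrow>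
      \<bar>y$1 - 1 / 2 ^ length w * (of_int (fst (index w)) + 1/2)\<bar> \<le> 1 / 2 ^ length w / 2 \<and>
      \<bar>y$2 - 1 / 2 ^ length w * (of_int (snd (index w)) + 1/2)\<bar> \<le> 1 / 2 ^ length w / 2" for y
    unfolding unit_square_iff vector_minus_component vector_scaleR_component lattice_point_nth
      real_scaleR_def *[OF zero_less_power[OF zero_less_numeral], symmetric] by blast
  then show ?thesis
    unfolding set_eq_iff mem_cell_iff square_def mem_Collect_eq vector_scaleR_component
      vector_add_component lattice_point_nth vector_2 real_scaleR_def by blast
qed

text \<open>The one-dimensional case of the comparison of side lengths below: an interval of length \<open>l'\<close>
  that contains both end points of one of length \<open>l\<close>, with centres at distance \<open>\<bar>u\<bar>\<close>, leaves room
  \<open>\<bar>u\<bar>\<close> on one side.\<close>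

lemma interval_subset_bound:
  fixes u l l' :: real
  assumes "\<bar>u + l/2\<bar> \<le> l'/2" "\<bar>u - l/2\<bar> \<le> l'/2"
  shows "l \<le> l' - 2 * \<bar>u\<bar>"
  using assms by linarith

lemma square_subset:
  assumes "square x l \<subseteq> square x' l'" "l > 0"
  shows "l \<le> l' - 2 * \<bar>x$1 - x'$1\<bar>" "l \<le> l' - 2 * \<bar>x$2 - x'$2\<bar>"
proof -
  have "x + vector [l/2, l/2] \<in> square x l" "x - vector [l/2, l/2] \<in> square x l"
    using assms(2) by (auto simp: square_def)
  with assms(1) have "x + vector [l/2, l/2] \<in> square x' l'" "x - vector [l/2, l/2] \<in> square x' l'"
    by auto
  then show "l \<le> l' - 2 * \<bar>x$1 - x'$1\<bar>" "l \<le> l' - 2 * \<bar>x$2 - x'$2\<bar>"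
    by (intro interval_subset_bound; simp add: square_def algebra_simps)+
qed

lemma square_inject:
  assumes "square x l = square x' l'" "l > 0"
  shows "x = x'" "l = l'"
proof -
  have aux: "u = 0 \<and> l = l'" if "l \<le> l' - 2 * \<bar>u\<bar>" "l' \<le> l - 2 * \<bar>- u\<bar>" for u
    using that by linarith
  have pos: "0 < l'" if "0 < l" "l \<le> l' - 2 * \<bar>u\<bar>" for u
    using that by linarith
  have *: "l \<le> l' - 2 * \<bar>x$1 - x'$1\<bar>" "l \<le> l' - 2 * \<bar>x$2 - x'$2\<bar>"
    using square_subset[of x l x' l'] assms by blast+
  have "l' > 0"
    using assms(2) *(1) by (rule pos)
  then have "l' \<le> l - 2 * \<bar>- (x$1 - x'$1)\<bar>" "l' \<le> l - 2 * \<bar>- (x$2 - x'$2)\<bar>"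
    using square_subset[of x' l' x l] assms(1) by (simp_all only: minus_diff_eq subset_refl)
  from aux[OF *(1) this(1)] aux[OF *(2) this(2)] show "x = x'" "l = l'"
    by (simp_all add: vec_eq_iff forall_2)
qed

section \<open>Neighbouring cells as lattice displacements\<close>

definition displacements :: "int \<times> int \<Rightarrow> (int \<times> int) set" where
  "displacements p = {v. \<bar>fst v\<bar> = fst p \<and> \<bar>snd v\<bar> = snd p \<or> \<bar>fst v\<bar> = snd p \<and> \<bar>snd v\<bar> = fst p}"

text \<open>A square determines its centre and its side length (\<open>square_inject\<close>), so in the definition of
  being neighbours the centres must be those of the two cells and the side must be \<open>1 / 2 ^ m\<close>.
  Multiplying by \<open>2 ^ m\<close> turns the condition into one on integers.\<close>

lemma neighbors_cells_iff:
  assumes "w \<in> words m" "w' \<in> words m"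
  shows "neighbors p (cell w') (cell w) \<longleftrightarrow> index w' - index w \<in> displacements p"
proof -
  define z where "z u = (1 / 2 ^ m) *\<^sub>R (lattice_point (index u) + vector [1/2, 1/2])" for u
  have cell: "cell w = square (z w) (1 / 2 ^ m)" "cell w' = square (z w') (1 / 2 ^ m)"
    using assms by (simp_all add: cell_eq_square words_def z_def)
  have "neighbors p (cell w') (cell w) \<longleftrightarrow>
      \<bar>z w'$1 - z w$1\<bar> = of_int (fst p) * (1/2^m) \<and> \<bar>z w'$2 - z w$2\<bar> = of_int (snd p) * (1/2^m) \<or>
      \<bar>z w'$1 - z w$1\<bar> = of_int (snd p) * (1/2^m) \<and> \<bar>z w'$2 - z w$2\<bar> = of_int (fst p) * (1/2^m)"
    (is "_ \<longleftrightarrow> ?R")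
  proof
    assume "neighbors p (cell w') (cell w)"
    then show ?R
      unfolding neighbors_def cell by (metis square_inject)
  next
    assume ?R
    then show "neighbors p (cell w') (cell w)"
      unfolding neighbors_def cell by (intro exI[of _ "z w'"] exI[of _ "z w"] exI[of _ "1/2^m"]) simp
  qed
  moreover have "\<bar>z w'$1 - z w$1\<bar> = of_int q * (1/2^m) \<longleftrightarrow> \<bar>fst (index w' - index w)\<bar> = q" for q
  proof -
    have "\<bar>z w'$1 - z w$1\<bar> = of_int \<bar>fst (index w' - index w)\<bar> * (1/2^m)"
      by (simp add: z_def abs_mult flip: right_diff_distrib diff_divide_distrib)
    then show ?thesis by (simp flip: of_int_abs)
  qed
  moreover have "\<bar>z w'$2 - z w$2\<bar> = of_int q * (1/2^m) \<longleftrightarrow> \<bar>snd (index w' - index w)\<bar> = q" for q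
  proof -
    have "\<bar>z w'$2 - z w$2\<bar> = of_int \<bar>snd (index w' - index w)\<bar> * (1/2^m)"
      by (simp add: z_def abs_mult flip: right_diff_distrib diff_divide_distrib)
    then show ?thesis by (simp flip: of_int_abs)
  qed
  ultimately show ?thesis
    unfolding displacements_def by simp
qed


section \<open>Continuously differentiable functions on the square\<close>

text \<open>Every linear functional is the inner product with a vector, namely with the value of its adjoint
  at \<open>1\<close>; so the choice in the definition of the gradient is made from a nonempty set.\<close>

lemma C1_has_derivative:
  assumes "f \<in> C1_square" "x \<in> unit_square"
  shows "(f has_derivative (\<lambda>h. grad f x \<bullet> h)) (at x within unit_square)"
proof -
  obtain D where D: "(f has_derivative D) (at x within unit_square)"
    using assms by (auto simp: C1_square_def differentiable_on_def differentiable_def)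
  have "D = (\<lambda>h. adjoint D 1 \<bullet> h)"
    using adjoint_works[OF has_derivative_linear[OF D], of _ 1] by (auto simp: inner_commute)
  with D have "(f has_derivative (\<lambda>h. adjoint D 1 \<bullet> h)) (at x within unit_square)"
    by metis
  then show ?thesis
    unfolding grad_def by (rule someI)
qed

lemma C1_continuous_on: "f \<in> C1_square \<Longrightarrow> continuous_on unit_square f"
  by (simp add: C1_square_def differentiable_imp_continuous_on)

lemma C1_continuous_on_grad: "f \<in> C1_square \<Longrightarrow> continuous_on unit_square (grad f)"
  by (simp add: C1_square_def)

lemma convex_unit_square: "convex unit_square"
  by (simp add: unit_square_def)

lemma C1_mean_value:
  assumes f: "f \<in> C1_square" and x: "x \<in> unit_square" and y: "x + h \<in> unit_square"
  obtains t where "0 \<le> t" "t \<le> 1" "x + t *\<^sub>R h \<in> unit_square"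
    "f (x + h) - f x = grad f (x + t *\<^sub>R h) \<bullet> h"
proof -
  have seg: "x + t *\<^sub>R h \<in> unit_square" if "t \<in> {0..1}" for t
    using convexD_alt[OF convex_unit_square x y, of t] that by (simp add: algebra_simps)
  have "((\<lambda>t. f (x + t *\<^sub>R h)) has_derivative (\<lambda>s. grad f (x + t *\<^sub>R h) \<bullet> (s *\<^sub>R h))) (at t within {0..1})"
    if "0 \<le> t" "t \<le> 1" for t
    by (rule has_derivative_in_compose2[OF C1_has_derivative[OF f]])
       (use seg that in \<open>auto intro!: derivative_eq_intros\<close>)
  from mvt_very_simple[OF zero_le_one this]
  obtain t where "t \<in> {0..1}"
    "f (x + 1 *\<^sub>R h) - f (x + 0 *\<^sub>R h) = grad f (x + t *\<^sub>R h) \<bullet> ((1 - 0) *\<^sub>R h)"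
    by blast
  with seg[of t] that[of t] show ?thesis by auto
qed

section \<open>Difference quotients of cell means\<close>

text \<open>The mean over the cell of \<open>k\<close>, pulled back to the unit square.  In this form means over
  different cells are integrals over the same set and can be subtracted pointwise.\<close>

definition cell_mean :: "nat \<Rightarrow> int \<times> int \<Rightarrow> (real^2 \<Rightarrow> real) \<Rightarrow> real" where
  "cell_mean N k f = integral unit_square (\<lambda>y. f ((1 / real N) *\<^sub>R (lattice_point k + y)))"

lemma grid_point_in_unit_square:
  assumes "k \<in> grid N" "y \<in> unit_square"
  shows "(1 / real N) *\<^sub>R (lattice_point k + y) \<in> unit_square"
proof -
  have "0 \<le> fst k" "0 \<le> snd k" "fst k + 1 \<le> int N" "snd k + 1 \<le> int N"
    using assms(1) by (auto simp: grid_def mem_Times_iff)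
  then have "0 \<le> real_of_int (fst k)" "0 \<le> real_of_int (snd k)"
    "real_of_int (fst k) + 1 \<le> real N" "real_of_int (snd k) + 1 \<le> real N"
    by linarith+
  then show ?thesis
    using assms(2) by (simp add: unit_square_iff divide_simps)
qed

lemma has_integral_cell_mean:
  assumes "continuous_on unit_square f" "k \<in> grid N"
  shows "((\<lambda>y. f ((1 / real N) *\<^sub>R (lattice_point k + y))) has_integral cell_mean N k f) unit_square"
proof -
  have "continuous_on unit_square (\<lambda>y. f ((1 / real N) *\<^sub>R (lattice_point k + y)))"
    by (rule continuous_on_compose2[OF assms(1)])
       (use grid_point_in_unit_square[OF assms(2)] in \<open>auto intro!: continuous_intros\<close>)
  then show ?thesis
    unfolding cell_mean_def unit_square_def
    by (intro integrable_integral integrable_continuous)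
qed

lemma content_unit_square: "measure lborel unit_square = 1"
  by (simp add: unit_square_def content_cbox_cart interval_ne_empty_cart)

text \<open>The bound \<open>2\<close> is that of the \<open>l\<^sup>1\<close> norm; any constant serves, as it is divided by \<open>N\<close> later.\<close>

lemma norm_unit_square: "y \<in> unit_square \<Longrightarrow> norm y \<le> 2"
  using norm_le_l1_cart[of y] by (simp add: unit_square_iff sum_2)

text \<open>The form of the mean value theorem on which the limit rests: if \<open>\<nabla>f \<bullet> v\<close> is within \<open>e\<close> of \<open>q\<close> at all
  points at distance \<open>O(1/N)\<close> from the cell of \<open>k\<close>, then so is the scaled difference of the means.  With
  \<open>q\<close> the value at a point it gives convergence, with \<open>q = 0\<close> a uniform bound.\<close>

lemma cell_mean_difference_close:
  assumes f: "f \<in> C1_square" and k: "k \<in> grid N" "k + v \<in> grid N" and e: "0 \<le> e"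
    and close: "\<And>z. z \<in> unit_square \<Longrightarrow>
      norm (real N *\<^sub>R z - lattice_point k) \<le> 2 + norm (lattice_point v) \<Longrightarrow>
      \<bar>grad f z \<bullet> lattice_point v - q\<bar> \<le> e"
  shows "\<bar>real N * (cell_mean N (k + v) f - cell_mean N k f) - q\<bar> \<le> e"
proof -
  have N: "real N > 0" using k by (auto simp: grid_def)
  define a where "a y = (1 / real N) *\<^sub>R (lattice_point k + y)" for y
  define h where "h = (1 / real N) *\<^sub>R lattice_point v"
  have "(\<lambda>y. (1 / real N) *\<^sub>R (lattice_point (k + v) + y)) = (\<lambda>y. a y + h)"
    by (auto simp: a_def h_def lattice_point_add algebra_simps)
  then have ah: "a y + h = (1 / real N) *\<^sub>R (lattice_point (k + v) + y)" for y by metis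
  have "((\<lambda>y. real N * (f (a y + h) - f (a y)) - q) has_integral
      (real N * (cell_mean N (k + v) f - cell_mean N k f) - measure lborel unit_square *\<^sub>R q)) unit_square"
    unfolding ah unfolding a_def unit_square_def
    by (intro has_integral_diff has_integral_mult_right has_integral_const
        has_integral_cell_mean[unfolded unit_square_def] C1_continuous_on[unfolded unit_square_def] f k)
  moreover have "norm (real N * (f (a y + h) - f (a y)) - q) \<le> e" if y: "y \<in> unit_square" for y
  proof -
    have "a y \<in> unit_square" "a y + h \<in> unit_square"
      unfolding ah unfolding a_def using grid_point_in_unit_square k y by blast+
    then obtain t where t: "0 \<le> t" "t \<le> 1" and z: "a y + t *\<^sub>R h \<in> unit_square"
      and eq: "f (a y + h) - f (a y) = grad f (a y + t *\<^sub>R h) \<bullet> h"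
      using C1_mean_value[OF f] by blast
    have "real N *\<^sub>R (a y + t *\<^sub>R h) - lattice_point k = y + t *\<^sub>R lattice_point v"
      using N by (simp add: a_def h_def scaleR_add_right)
    also have "norm \<dots> \<le> 2 + norm (lattice_point v)"
      using norm_triangle_ineq[of y "t *\<^sub>R lattice_point v"] norm_unit_square[OF y] t
        mult_left_le_one_le[of "norm (lattice_point v)" t] by simp
    finally have "\<bar>grad f (a y + t *\<^sub>R h) \<bullet> lattice_point v - q\<bar> \<le> e"
      using close z by blast
    moreover have "real N * (f (a y + h) - f (a y)) = grad f (a y + t *\<^sub>R h) \<bullet> lattice_point v"
      using N unfolding eq by (simp add: h_def)
    ultimately show ?thesis by simp
  qed
  ultimately have "norm (real N * (cell_mean N (k + v) f - cell_mean N k f) - measure lborel unit_square *\<^sub>R q)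
      \<le> e * measure lborel unit_square"
    using e unfolding unit_square_def by (intro has_integral_bound)
  then show ?thesis by (simp add: content_unit_square)
qed

text \<open>Rounding down assigns every point to exactly one half-open cell, so that no point is counted
  twice; the cells themselves overlap in their edges.\<close>

definition cell_index :: "nat \<Rightarrow> real^2 \<Rightarrow> int \<times> int" where
  "cell_index N x = (\<lfloor>real N * x$1\<rfloor>, \<lfloor>real N * x$2\<rfloor>)"

lemma cell_offset_in_unit_square:
  "real N *\<^sub>R x - lattice_point (cell_index N x) \<in> unit_square"
  by (simp add: unit_square_iff cell_index_def) linarith

text \<open>The value \<open>0\<close> is for cells that \<open>v\<close> moves out of the square; they have no counterpart in the sum
  over pairs of cells.  It also makes the function vanish outside the square.\<close>

definition difference_quotient :: "nat \<Rightarrow> int \<times> int \<Rightarrow> (real^2 \<Rightarrow> real) \<Rightarrow> real^2 \<Rightarrow> real" where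
  "difference_quotient N v f x =
    (if cell_index N x \<in> grid N \<and> cell_index N x + v \<in> grid N
     then real N * (cell_mean N (cell_index N x + v) f - cell_mean N (cell_index N x) f)
     else 0)"

text \<open>A shift by \<open>v\<close> moves a cell by a distance of order \<open>1/N\<close>, which is less than the distance of an interior
  point to the boundary once \<open>N\<close> is large.\<close>

lemma eventually_cell_index_in_grid:
  assumes "x \<in> box 0 1"
  shows "eventually (\<lambda>N. cell_index N x + v \<in> grid N) sequentially"
proof -
  have coord: "eventually (\<lambda>N. 0 \<le> \<lfloor>real N * s\<rfloor> + j \<and> \<lfloor>real N * s\<rfloor> + j < int N) sequentially"
    if s: "0 < s" "s < 1" for s and j :: int
  proof -
    have "eventually (\<lambda>N. 1 - of_int j \<le> real N * s) sequentially"
      using s by real_asymp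
    moreover have "eventually (\<lambda>N. of_int j < real N * (1 - s)) sequentially"
      using s by real_asymp
    ultimately show ?thesis
    proof eventually_elim
      case (elim N)
      then have "of_int j < real N - real N * s" by (simp add: algebra_simps)
      with elim(1) show ?case by linarith
    qed
  qed
  have "0 < x$1" "x$1 < 1" "0 < x$2" "x$2 < 1"
    using assms by (auto simp: mem_box_cart forall_2)
  from coord[OF this(1,2), of "fst v"] coord[OF this(3,4), of "snd v"] show ?thesis
    by eventually_elim (simp add: grid_def cell_index_def mem_Times_iff)
qed

text \<open>All points at which the gradient enters are within \<open>(4 + \<parallel>v\<parallel>)/N\<close> of \<open>x\<close>: \<open>2 + \<parallel>v\<parallel>\<close> from the cell and the
  segment along \<open>v\<close>, and another \<open>2\<close> from the corner of the cell to \<open>x\<close>.\<close>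

lemma difference_quotient_tendsto:
  assumes f: "f \<in> C1_square" and x: "x \<in> box 0 1"
  shows "(\<lambda>N. difference_quotient N v f x) \<longlonglongrightarrow> grad f x \<bullet> lattice_point v"
proof (rule tendstoI)
  fix e :: real assume e: "e > 0"
  have xS: "x \<in> unit_square" using x box_subset_cbox by (auto simp: unit_square_def)
  have "continuous_on unit_square (\<lambda>z. grad f z \<bullet> lattice_point v)"
    by (intro continuous_intros C1_continuous_on_grad f)
  then obtain d where d: "d > 0" and
    cont: "\<And>z. z \<in> unit_square \<Longrightarrow> dist z x < d \<Longrightarrow>
      dist (grad f z \<bullet> lattice_point v) (grad f x \<bullet> lattice_point v) < e / 2"
    using xS e by (metis continuous_on_iff half_gt_zero)
  have "eventually (\<lambda>N. 4 + norm (lattice_point v) < real N * d) sequentially"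
    using d by real_asymp
  moreover have "eventually (\<lambda>N. cell_index N x \<in> grid N) sequentially"
    using eventually_cell_index_in_grid[OF x, of 0] by simp
  moreover note eventually_cell_index_in_grid[OF x, of v]
  ultimately show "eventually (\<lambda>N. dist (difference_quotient N v f x) (grad f x \<bullet> lattice_point v) < e) sequentially"
  proof eventually_elim
    case (elim N)
    have "\<bar>real N * (cell_mean N (cell_index N x + v) f - cell_mean N (cell_index N x) f)
        - grad f x \<bullet> lattice_point v\<bar> \<le> e / 2"
    proof (rule cell_mean_difference_close[OF f elim(2,3)])
      fix z assume z: "z \<in> unit_square"
        and "norm (real N *\<^sub>R z - lattice_point (cell_index N x)) \<le> 2 + norm (lattice_point v)"
      then have "norm (real N *\<^sub>R z - real N *\<^sub>R x) \<le> 4 + norm (lattice_point v)"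
        using norm_unit_square[OF cell_offset_in_unit_square, of N x] norm_triangle_ineq4[of "real N *\<^sub>R z - lattice_point (cell_index N x)"
            "real N *\<^sub>R x - lattice_point (cell_index N x)"] by simp
      also have "\<dots> < real N * d" by fact
      finally have "real N * dist z x < real N * d"
        by (simp add: dist_norm flip: scaleR_diff_right)
      then have "dist z x < d" by (simp add: mult_less_cancel_left)
      from cont[OF z this] show "\<bar>grad f z \<bullet> lattice_point v - grad f x \<bullet> lattice_point v\<bar> \<le> e / 2"
        by (simp add: dist_real_def)
    qed (use e in simp)
    with elim e show ?case
      by (simp add: difference_quotient_def dist_real_def)
  qed
qed

lemma difference_quotient_bound:
  assumes f: "f \<in> C1_square"
  obtains B where "0 \<le> B" "\<And>N x. \<bar>difference_quotient N v f x\<bar> \<le> B * indicator unit_square x"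
proof -
  have "continuous_on unit_square (\<lambda>z. grad f z \<bullet> lattice_point v)"
    by (intro continuous_intros C1_continuous_on_grad f)
  then have "bounded ((\<lambda>z. grad f z \<bullet> lattice_point v) ` unit_square)"
    by (simp add: compact_imp_bounded compact_continuous_image unit_square_def)
  then obtain B where B: "0 < B" "\<And>z. z \<in> unit_square \<Longrightarrow> \<bar>grad f z \<bullet> lattice_point v\<bar> \<le> B"
    unfolding bounded_pos by auto
  have "\<bar>difference_quotient N v f x\<bar> \<le> B * indicator unit_square x" for N x
  proof (cases "cell_index N x \<in> grid N \<and> cell_index N x + v \<in> grid N")
    case True
    have "x = (1 / real N) *\<^sub>R (lattice_point (cell_index N x) + (real N *\<^sub>R x - lattice_point (cell_index N x)))"
      using True by (auto simp: grid_def)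
    then have "x \<in> unit_square"
      using True grid_point_in_unit_square cell_offset_in_unit_square by metis
    with True show ?thesis
      using cell_mean_difference_close[of f "cell_index N x" N v B 0] f B
      by (simp add: difference_quotient_def)
  qed (use B in \<open>auto simp: difference_quotient_def\<close>)
  with B(1) that[of B] show ?thesis by simp
qed

section \<open>The limit of the energy of one shift\<close>

definition shift_energy :: "nat \<Rightarrow> int \<times> int \<Rightarrow> (real^2 \<Rightarrow> real) \<Rightarrow> (real^2 \<Rightarrow> real) \<Rightarrow> real" where
  "shift_energy N v f g = (\<Sum>k | k \<in> grid N \<and> k + v \<in> grid N.
    (cell_mean N (k + v) f - cell_mean N k f) * (cell_mean N (k + v) g - cell_mean N k g))"

text \<open>A half-open cell differs from its closure by a subset of the boundary, which is negligible.\<close>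

lemma lattice_cell:
  assumes "N > 0"
  shows "{x. cell_index N x = k} \<in> lmeasurable" "measure lebesgue {x. cell_index N x = k} = 1 / (real N)\<^sup>2"
proof -
  define a b where "a = (1 / real N) *\<^sub>R lattice_point k" and "b = (1 / real N) *\<^sub>R (lattice_point k + 1)"
  have N: "real N > 0" using assms by simp
  have iff: "cell_index N x = k \<longleftrightarrow> a$1 \<le> x$1 \<and> x$1 < b$1 \<and> a$2 \<le> x$2 \<and> x$2 < b$2" for x
    using N by (auto simp: cell_index_def a_def b_def prod_eq_iff floor_eq_iff field_simps)
  have sub: "box a b \<subseteq> {x. cell_index N x = k}" "{x. cell_index N x = k} \<subseteq> cbox a b"
    unfolding iff by (auto simp: mem_box_cart forall_2)
  have neg: "negligible (sym_diff (cbox a b) {x. cell_index N x = k})"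
    by (rule negligible_subset[OF negligible_frontier_interval[of a b]]) (use sub in auto)
  show "{x. cell_index N x = k} \<in> lmeasurable"
    using lmeasurable_negligible_symdiff[OF lmeasurable_cbox neg] .
  have "measure lebesgue {x. cell_index N x = k} = measure lebesgue (cbox a b)"
    using measure_negligible_symdiff[OF lmeasurable_cbox neg] .
  also have "\<dots> = measure lborel (cbox a b)" by simp
  also have "\<dots> = 1 / (real N)\<^sup>2"
    using N by (subst content_cbox_cart)
      (auto simp: interval_ne_empty_cart a_def b_def forall_2 prod_2 divide_simps power2_eq_square)
  finally show "measure lebesgue {x. cell_index N x = k} = 1 / (real N)\<^sup>2" .
qed

text \<open>The product is constant on each half-open cell; at most one summand is nonzero at a given point.\<close>

lemma difference_quotient_product:
  "difference_quotient N v f x * difference_quotient N v g x =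
    (\<Sum>k | k \<in> grid N \<and> k + v \<in> grid N.
      ((real N)\<^sup>2 * ((cell_mean N (k + v) f - cell_mean N k f) * (cell_mean N (k + v) g - cell_mean N k g)))
       * indicator {x. cell_index N x = k} x)"
proof -
  have fin: "finite {k. k \<in> grid N \<and> k + v \<in> grid N}" 
    using finite_grid by simp
  define d where "d k = (real N)\<^sup>2 *
    ((cell_mean N (k + v) f - cell_mean N k f) * (cell_mean N (k + v) g - cell_mean N k g))" for k
  have "(\<Sum>k | k \<in> grid N \<and> k + v \<in> grid N. d k * indicator {x. cell_index N x = k} x) =
      (\<Sum>k | k \<in> grid N \<and> k + v \<in> grid N. if cell_index N x = k then d k else 0)"
    by (intro sum.cong) (auto simp: indicator_def)
  also have "\<dots> = (if cell_index N x \<in> grid N \<and> cell_index N x + v \<in> grid N then d (cell_index N x) else 0)"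
    using fin by simp
  also have "\<dots> = difference_quotient N v f x * difference_quotient N v g x"
    by (simp add: d_def difference_quotient_def power2_eq_square)
  finally show ?thesis by (simp add: d_def)
qed

lemma has_bochner_integral_difference_quotient_product:
  assumes "N > 0"
  shows "has_bochner_integral lebesgue
    (\<lambda>x. difference_quotient N v f x * difference_quotient N v g x) (shift_energy N v f g)"
proof -
  have "has_bochner_integral lebesgue (indicator {x. cell_index N x = k} :: _ \<Rightarrow> real) (1 / (real N)\<^sup>2)" for k
    using lattice_cell[OF assms, of k]
      has_bochner_integral_real_indicator[of "{x. cell_index N x = k}" lebesgue]
    by (simp only: fmeasurable_def mem_Collect_eq infinity_ennreal_def simp_thms)
  then have "has_bochner_integral lebesgue
    (\<lambda>x. difference_quotient N v f x * difference_quotient N v g x)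
    (\<Sum>k | k \<in> grid N \<and> k + v \<in> grid N.
      ((real N)\<^sup>2 * ((cell_mean N (k + v) f - cell_mean N k f) * (cell_mean N (k + v) g - cell_mean N k g)))
       * (1 / (real N)\<^sup>2))"
    unfolding difference_quotient_product
    by (intro has_bochner_integral_sum has_bochner_integral_mult_right)
  then show ?thesis
    using assms by (simp add: shift_energy_def)
qed

text \<open>The step functions converge in the interior by continuity of the gradients, are supported in the
  square and are uniformly bounded, and the boundary is a null set.\<close>

lemma shift_energy_tendsto:
  assumes f: "f \<in> C1_square" and g: "g \<in> C1_square"
  shows "(\<lambda>N. shift_energy N v f g) \<longlonglongrightarrow>
    (LINT x:unit_square|lebesgue. (grad f x \<bullet> lattice_point v) * (grad g x \<bullet> lattice_point v))"
proof -
  obtain B where B: "0 \<le> B" "\<And>N x. \<bar>difference_quotient N v f x\<bar> \<le> B * indicator unit_square x"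
    using difference_quotient_bound[OF f] by blast
  obtain C where C: "0 \<le> C" "\<And>N x. \<bar>difference_quotient N v g x\<bar> \<le> C * indicator unit_square x"
    using difference_quotient_bound[OF g] by blast
  let ?h = "\<lambda>x. (grad f x \<bullet> lattice_point v) * (grad g x \<bullet> lattice_point v)"
  let ?s = "\<lambda>N x. difference_quotient (Suc N) v f x * difference_quotient (Suc N) v g x"
  \<comment> \<open>The index is shifted because the step functions represent the energy for \<open>N > 0\<close>.\<close>
  have "(\<lambda>N. integral\<^sup>L lebesgue (?s N)) \<longlonglongrightarrow> integral\<^sup>L lebesgue (\<lambda>x. indicator unit_square x *\<^sub>R ?h x)"
  proof (rule integral_dominated_convergence)
    have "continuous_on unit_square ?h"
      by (intro continuous_intros C1_continuous_on_grad f g)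
    then have "set_integrable lebesgue unit_square ?h"
      unfolding unit_square_def by (rule absolutely_integrable_continuous)
    then show "(\<lambda>x. indicator unit_square x *\<^sub>R ?h x) \<in> borel_measurable lebesgue"
      unfolding set_integrable_def by (rule borel_measurable_integrable)
    show "?s N \<in> borel_measurable lebesgue" for N
      by (rule borel_measurable_has_bochner_integral[OF has_bochner_integral_difference_quotient_product]) simp
    show "integrable lebesgue (\<lambda>x. (B * C) * indicator unit_square x)"
      unfolding unit_square_def
      by (intro integrable_mult_right integrable_real_indicator) (use emeasure_bounded_finite[OF bounded_cbox, of "0::real^2" 1] in auto)
    show "AE x in lebesgue. norm (?s N x) \<le> (B * C) * indicator unit_square x" for N
    proof (rule AE_I2)
      fix x
      have "norm (?s N x) \<le> (B * indicator unit_square x) * (C * indicator unit_square x)"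
        unfolding real_norm_def abs_mult by (intro mult_mono B C) (auto simp: B C)
      then show "norm (?s N x) \<le> (B * C) * indicator unit_square x"
        by (auto simp: indicator_def split: if_splits)
    qed
    have "AE x in lebesgue. x \<notin> unit_square - box 0 1"
      using negligible_frontier_interval[of "0::real^2" 1]
      by (intro AE_not_in) (simp add: negligible_iff_null_sets unit_square_def)
    then show "AE x in lebesgue. (\<lambda>N. ?s N x) \<longlonglongrightarrow> indicator unit_square x *\<^sub>R ?h x"
    proof eventually_elim
      case (elim x)
      show ?case
      proof (cases "x \<in> unit_square")
        case True
        with elim have x: "x \<in> box 0 1" by auto
        show ?thesis
          using True LIMSEQ_Suc[OF tendsto_mult[OF difference_quotient_tendsto[OF f x] difference_quotient_tendsto[OF g x]]]
          by simp
      next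
        case False
        then have "difference_quotient (Suc N) v f x = 0" for N
          using B(2)[of "Suc N" x] by simp
        then show ?thesis using False by simp
      qed
    qed
  qed
  moreover have "integral\<^sup>L lebesgue (?s N) = shift_energy (Suc N) v f g" for N
    using has_bochner_integral_integral_eq[OF has_bochner_integral_difference_quotient_product] by blast
  ultimately show ?thesis
    unfolding set_lebesgue_integral_def
    by (simp only: filterlim_sequentially_Suc[of "\<lambda>N. shift_energy N v f g"])
qed


section \<open>Sums over neighbouring cells\<close>

text \<open>The affine change of variables that maps the unit square onto the cell has Jacobian
  \<open>(1 / 2 ^ m)\<^sup>2\<close>, which is the area of the cell.\<close>

lemma cell_avg_eq_cell_mean:
  assumes f: "continuous_on unit_square f" and w: "w \<in> words m"
  shows "cell_avg w f = cell_mean (2 ^ m) (index w) f"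
proof -
  define a b where "a = (1 / 2 ^ m) *\<^sub>R lattice_point (index w)"
    and "b = (1 / 2 ^ m) *\<^sub>R (lattice_point (index w) + 1)"
  have len: "length w = m" using w by (simp add: words_def)
  have cell: "cell w = cbox a b"
    by (auto simp: mem_cell_iff len unit_square_iff a_def b_def mem_box_cart forall_2 pos_divide_le_eq pos_le_divide_eq mult.commute)
  have "cell w \<subseteq> unit_square"
    using grid_point_in_unit_square[OF index_in_grid[OF w]] by (auto simp: cell_def F_word_eq len)
  then have cont: "continuous_on (cbox a b) f"
    using f cell continuous_on_subset by blast
  then have int: "(LINT x:cell w|lebesgue. f x) = integral (cbox a b) f"
    unfolding cell by (intro set_lebesgue_integral_eq_integral(2) absolutely_integrable_continuous)
  have "measure lborel (cbox a b) = (1 / 2 ^ m)\<^sup>2"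
    by (subst content_cbox_cart)
      (auto simp: interval_ne_empty_cart a_def b_def forall_2 prod_2 divide_simps power2_eq_square)
  then have meas: "measure lebesgue (cell w) = (1 / 2 ^ m)\<^sup>2"
    unfolding cell by simp
  have "((\<lambda>x. f ((1 / 2 ^ m) *\<^sub>R x + a)) has_integral (integral (cbox a b) f /\<^sub>R (1 / 2 ^ m) ^ DIM(real^2)))
      (cbox ((a - a) /\<^sub>R (1 / 2 ^ m)) ((b - a) /\<^sub>R (1 / 2 ^ m)))"
    by (intro has_integral_affinity' integrable_integral integrable_continuous cont) simp
  moreover have "(b - a) /\<^sub>R (1 / 2 ^ m) = 1"
    by (simp add: a_def b_def flip: scaleR_diff_right)
  moreover have "(1 / 2 ^ m) *\<^sub>R x + a = (1 / real (2 ^ m)) *\<^sub>R (lattice_point (index w) + x)" for x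
    by (simp add: a_def scaleR_add_right)
  ultimately have "((\<lambda>x. f ((1 / real (2 ^ m)) *\<^sub>R (lattice_point (index w) + x)))
      has_integral (integral (cbox a b) f / (1 / 2 ^ m)\<^sup>2)) unit_square"
    by (simp add: unit_square_def divide_inverse_commute)
  then have "cell_mean (2 ^ m) (index w) f = integral (cbox a b) f / (1 / 2 ^ m)\<^sup>2"
    unfolding cell_mean_def by (rule integral_unique)
  then show ?thesis
    by (simp add: cell_avg_def int meas)
qed

text \<open>The map from ordered to unordered pairs is two-to-one off the diagonal.\<close>

lemma sum_over_unordered_pairs:
  fixes h :: "'a uprod \<Rightarrow> real"
  assumes fin: "finite R" and sym: "\<And>x y. (x, y) \<in> R \<Longrightarrow> (y, x) \<in> R" and irr: "\<And>x. (x, x) \<notin> R"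
  shows "(\<Sum>(x, y)\<in>R. h (Upair x y)) = 2 * (\<Sum>e\<in>(\<lambda>(x, y). Upair x y) ` R. h e)"
proof -
  let ?U = "\<lambda>(x, y). Upair x y"
  have "(\<Sum>z\<in>R. h (?U z)) = (\<Sum>e\<in>?U ` R. \<Sum>z | z \<in> R \<and> ?U z = e. h (?U z))"
    by (rule sum.image_gen[OF fin])
  also have "\<dots> = (\<Sum>e\<in>?U ` R. 2 * h e)"
  proof (rule sum.cong[OF refl])
    fix e assume "e \<in> ?U ` R"
    then obtain x y where e: "e = Upair x y" and xy: "(x, y) \<in> R" by auto
    then have "x \<noteq> y" using irr by auto
    moreover have "{z. z \<in> R \<and> ?U z = e} = {(x, y), (y, x)}"
      using xy sym by (auto simp: e)
    ultimately show "(\<Sum>z | z \<in> R \<and> ?U z = e. h (?U z)) = 2 * h e"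
      using arg_cong[of "Upair y x" "Upair x y" h] by (simp add: e)
  qed
  finally show ?thesis
    by (simp add: sum_distrib_left case_prod_beta)
qed

lemma finite_displacements: "finite (displacements p)"
proof (rule finite_subset)
  let ?I = "{- \<bar>fst p\<bar> - \<bar>snd p\<bar>..\<bar>fst p\<bar> + \<bar>snd p\<bar>}"
  show "displacements p \<subseteq> ?I \<times> ?I"
    by (auto simp: displacements_def)
qed simp

text \<open>As \<open>p \<noteq> 0\<close>, no cell is its own neighbour, so every unordered pair comes from two ordered ones.
  Ordered pairs of words correspond to pairs of a displacement and a grid point.\<close>

lemma sum_neighbor_pairs:
  assumes f: "continuous_on unit_square f" and g: "continuous_on unit_square g" and p: "snd p \<noteq> 0"
  shows "(\<Sum>e\<in>neighbor_pairs p m. diff_product f g e)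
    = (\<Sum>v\<in>displacements p. shift_energy (2 ^ m) v f g) / 2"
proof -
  define R where "R = {(w, w'). w \<in> words m \<and> w' \<in> words m \<and> index w' - index w \<in> displacements p}"
  define D where "D k l = (cell_mean (2 ^ m) l f - cell_mean (2 ^ m) k f)
    * (cell_mean (2 ^ m) l g - cell_mean (2 ^ m) k g)" for k l
  have fin: "finite (words m)"
    using bij_betw_finite[OF bij_betw_index] finite_grid by blast
  have "finite R"
    by (rule finite_subset[of _ "words m \<times> words m"]) (use fin in \<open>auto simp: R_def\<close>)
  moreover have "(w', w) \<in> R" if "(w, w') \<in> R" for w w'
    using that by (auto simp: R_def displacements_def abs_minus_commute)
  moreover have "(w, w) \<notin> R" for w
    using p by (auto simp: R_def displacements_def)
  moreover have "neighbor_pairs p m = (\<lambda>(w, w'). Upair w w') ` R"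
    by (force simp: neighbor_pairs_def R_def neighbors_cells_iff)
  ultimately have "2 * (\<Sum>e\<in>neighbor_pairs p m. diff_product f g e)
      = (\<Sum>(w, w')\<in>R. diff_product f g (Upair w w'))"
    using sum_over_unordered_pairs[of R "diff_product f g"] by simp
  also have "\<dots> = (\<Sum>(w, w')\<in>R. D (index w) (index w'))"
    by (intro sum.cong) (auto simp: R_def D_def cell_avg_eq_cell_mean f g)
  also have "\<dots> = (\<Sum>(v, k)\<in>(SIGMA v:displacements p. {k. k \<in> grid (2 ^ m) \<and> k + v \<in> grid (2 ^ m)}). D k (k + v))"
  proof (rule sum.reindex_bij_witness)
    let ?word = "inv_into (words m) index"
    show "(case vk of (v, k) \<Rightarrow> (?word k, ?word (k + v))) \<in> R"
      "(case (case vk of (v, k) \<Rightarrow> (?word k, ?word (k + v))) of (w, w') \<Rightarrow> (index w' - index w, index w)) = vk"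
      if "vk \<in> (SIGMA v:displacements p. {k. k \<in> grid (2 ^ m) \<and> k + v \<in> grid (2 ^ m)})" for vk
      using that bij_betw_index[of m]
      by (auto simp: R_def bij_betw_inv_into_right bij_betw_apply[OF bij_betw_inv_into])
    show "(case (case ww of (w, w') \<Rightarrow> (index w' - index w, index w)) of (v, k) \<Rightarrow> (?word k, ?word (k + v))) = ww"
      "(case ww of (w, w') \<Rightarrow> (index w' - index w, index w))
        \<in> (SIGMA v:displacements p. {k. k \<in> grid (2 ^ m) \<and> k + v \<in> grid (2 ^ m)})"
      if "ww \<in> R" for ww
      using that bij_betw_index[of m]
      by (auto simp: R_def bij_betw_inv_into_left index_in_grid)
  qed (auto simp: R_def)
  also have "\<dots> = (\<Sum>v\<in>displacements p. shift_energy (2 ^ m) v f g)"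
    unfolding shift_energy_def D_def
    by (rule sum.Sigma[symmetric]) (auto intro: finite_displacements finite_subset[OF _ finite_grid])
  finally show ?thesis by simp
qed

text \<open>The mixed terms cancel because the displacements are closed under changing one sign, and both
  coordinates have the same sum of squares because they are closed under swapping.  The value follows
  from \<open>\<parallel>v\<parallel> = \<parallel>p\<parallel>\<close> and the number \<open>8 c\<^sub>p\<close> of displacements, which is \<open>4\<close> if \<open>p\<close> lies on an axis of symmetry
  of the square and \<open>8\<close> otherwise.\<close>

lemma displacements_isotropic:
  assumes p: "0 \<le> fst p" "fst p \<le> snd p" "snd p \<noteq> 0"
  shows "(\<Sum>v\<in>displacements p. (x \<bullet> lattice_point v) * (y \<bullet> lattice_point v))
    = 4 * (pnorm p)\<^sup>2 * c p * (x \<bullet> y)"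
proof -
  obtain a b where ab: "p = (a, b)" by (cases p)
  have inner: "x \<bullet> lattice_point v = x$1 * of_int (fst v) + x$2 * of_int (snd v)" for x v
    by (simp add: inner_vec_def sum_2)
  have norm: "(pnorm p)\<^sup>2 = (of_int a)\<^sup>2 + (of_int b)\<^sup>2"
    unfolding pnorm_def power2_norm_eq_inner by (simp add: ab inner_vec_def sum_2 power2_eq_square)
  have xy: "x \<bullet> y = x$1 * y$1 + x$2 * y$2"
    by (simp add: inner_vec_def sum_2)
  have "displacements p = {v. (fst v \<in> {a, - a} \<and> snd v \<in> {b, - b}) \<or> (fst v \<in> {b, - b} \<and> snd v \<in> {a, - a})}"
    using p by (simp add: displacements_def ab abs_eq_iff')
  then have disp: "displacements p = {a, - a} \<times> {b, - b} \<union> {b, - b} \<times> {a, - a}"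
    by (simp only: set_eq_iff mem_Collect_eq Un_iff mem_Times_iff simp_thms)
  consider "a = 0" "b > 0" | "a = b" "b > 0" | "0 < a" "a < b"
    using p ab by force
  then show ?thesis
  proof cases
    case 1
    then have "displacements p = {(0, b), (0, - b), (b, 0), (- b, 0)}"
      unfolding disp by auto
    with 1 show ?thesis
      unfolding inner norm xy by (simp add: c_def ab power2_eq_square algebra_simps)
  next
    case 2
    then have "displacements p = {(b, b), (b, - b), (- b, b), (- b, - b)}"
      unfolding disp by auto
    with 2 show ?thesis
      unfolding inner norm xy by (simp add: c_def ab power2_eq_square algebra_simps)
  next
    case 3
    have rectangle: "(\<Sum>v\<in>{s, - s} \<times> {t, - t}. h v) = h (s, t) + h (s, - t) + h (- s, t) + h (- s, - t)"
      if "0 < s" "0 < t" for s t :: int and h :: "int \<times> int \<Rightarrow> real"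
      using that by (simp flip: sum.cartesian_product')
    have "({a, - a} \<times> {b, - b}) \<inter> ({b, - b} \<times> {a, - a}) = {}"
      using 3 by auto
    then show ?thesis
      unfolding disp inner norm xy using 3
      by (subst sum.union_disjoint) (simp_all add: rectangle c_def ab power2_eq_square algebra_simps)
  qed
qed

section \<open>Convergence to the Dirichlet integral\<close>

lemma neighbor_sum_tendsto:
  assumes p: "0 \<le> fst p" "fst p \<le> snd p" "snd p \<noteq> 0" and f: "f \<in> C1_square" and g: "g \<in> C1_square"
  shows "(\<lambda>m. \<Sum>e\<in>neighbor_pairs p m. diff_product f g e) \<longlonglongrightarrow>
    2 * (pnorm p)\<^sup>2 * c p * (LINT x:unit_square|lebesgue. grad f x \<bullet> grad g x)"
proof -
  let ?h = "\<lambda>v x. (grad f x \<bullet> lattice_point v) * (grad g x \<bullet> lattice_point v)"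
  have "filterlim ((^) (2::nat)) sequentially sequentially"
    by (rule filterlim_subseq) (simp add: strict_mono_def)
  then have "(\<lambda>m. shift_energy (2 ^ m) v f g) \<longlonglongrightarrow> (LINT x:unit_square|lebesgue. ?h v x)" for v
    by (rule filterlim_compose[OF shift_energy_tendsto[OF f g]])
  then have "(\<lambda>m. (\<Sum>v\<in>displacements p. shift_energy (2 ^ m) v f g) / 2) \<longlonglongrightarrow>
      (\<Sum>v\<in>displacements p. LINT x:unit_square|lebesgue. ?h v x) / 2"
    by (intro tendsto_intros) simp_all
  moreover have "(\<Sum>v\<in>displacements p. LINT x:unit_square|lebesgue. ?h v x)
      = (LINT x:unit_square|lebesgue. 4 * (pnorm p)\<^sup>2 * c p * (grad f x \<bullet> grad g x))"
  proof -
    have "set_integrable lebesgue unit_square (?h v)" for v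
      unfolding unit_square_def
      by (intro absolutely_integrable_continuous continuous_intros C1_continuous_on_grad[unfolded unit_square_def] f g)
    then have "(\<Sum>v\<in>displacements p. LINT x:unit_square|lebesgue. ?h v x)
        = (LINT x:unit_square|lebesgue. \<Sum>v\<in>displacements p. ?h v x)"
      unfolding set_lebesgue_integral_def set_integrable_def scaleR_sum_right
      by (subst Bochner_Integration.integral_sum) auto
    then show ?thesis
      by (simp add: displacements_isotropic[OF p])
  qed
  ultimately show ?thesis
    by (simp add: sum_neighbor_pairs[OF C1_continuous_on[OF f] C1_continuous_on[OF g] p(3)] mult_ac)
qed

theorem theorem3p2:
  fixes P :: "(int \<times> int) set" and A :: "int \<times> int \<Rightarrow> real"
    and f g :: "real^2 \<Rightarrow> real"
  assumes "finite P"
    and "\<And>p. p \<in> P \<Longrightarrow> 0 \<le> fst p \<and> fst p \<le> snd p \<and> snd p \<noteq> 0"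
    and "8 * (\<Sum>p\<in>P. c p * A p) = 1"
    and "(\<Sum>p\<in>P. (pnorm p)\<^sup>2 * c p * A p) \<noteq> 0"
    and "f \<in> C1_square" and "g \<in> C1_square"
  shows "convergent (\<lambda>m. discrete_energy P A m f g) \<and>
         energy P A f g = (LINT x:unit_square|lebesgue. grad f x \<bullet> grad g x)"
proof -
  let ?I = "LINT x:unit_square|lebesgue. grad f x \<bullet> grad g x"
  have "(\<lambda>m. discrete_energy P A m f g) \<longlonglongrightarrow>
      M_const P A * (\<Sum>p\<in>P. A p * (2 * (pnorm p)\<^sup>2 * c p * ?I))"
    unfolding discrete_energy_def
    by (intro tendsto_mult tendsto_const tendsto_sum neighbor_sum_tendsto) (use assms in auto)
  \<comment> \<open>The factor \<open>1/2\<close> in the prefactor cancels the \<open>2\<close> of the neighbour sums.\<close>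
  also have "(\<Sum>p\<in>P. A p * (2 * (pnorm p)\<^sup>2 * c p * ?I)) = 2 * (\<Sum>p\<in>P. (pnorm p)\<^sup>2 * c p * A p) * ?I"
    by (simp add: sum_distrib_left sum_distrib_right mult_ac)
  also have "M_const P A * \<dots> = ?I"
    using assms(4) by (simp add: M_const_def)
  finally have "(\<lambda>m. discrete_energy P A m f g) \<longlonglongrightarrow> ?I" .
  then show ?thesis
    unfolding energy_def by (auto simp: convergent_def limI)
qed

end
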